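(* Let $\mathbb{U}_1$ be the Urysohn metric space of diameter one and let $\mathrm{Iso}(\mathbb{U}_1)$ be the topological group of all isometries of $\mathbb{U}_1$ onto itself with the topology of pointwise convergence. Then $\mathrm{Iso}(\mathbb{U}_1)$ admits no non-trivial continuous representations by isometries in reflexive Banach spaces. That is, if $E$ is a reflexive Banach space and $\pi\colon \mathrm{Iso}(\mathbb{U}_1)\to \mathrm{Iso}(E)$ is a continuous homomorphism, where $\mathrm{Iso}(E)$ is the group of linear isometries of $E$ onto itself equipped with the strong operator topology, then $\pi(g)$ is the identity operator for every $g\in\mathrm{Iso}(\mathbb{U}_1)$.
   Context: The Urysohn space of diameter one, $\mathbb{U}_1$, is the (unique up to isometry) metric space such that: (1) $\mathbb{U}_1$ is a complete separable metric space of diameter $1$, where the diameter of a metric space $X$ is $\sup\{d(x,y)\colon x,y\in X\}$; (2) every isometry between two finite metric subspaces of $\mathbb{U}_1$ extends to a global isometry of $\mathbb{U}_1$ onto itself; (3) $\mathbb{U}_1$ contains an isometric copy of every separable metric space of diameter one. *)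

theory Defs
  imports "HOL-Analysis.Analysis" "HOL-Algebra.Group"
begin

text \<open>The supremum is taken in the extended reals, so an unbounded space has diameter \<open>\<infinity>\<close>
  (and the empty space has diameter \<open>-\<infinity>\<close>).\<close>

definition metric_diameter :: "'a metric \<Rightarrow> ereal" where
  "metric_diameter m = (SUP (x, y) \<in> mspace m \<times> mspace m. ereal (mdist m x y))"

text \<open>The space is the whole type \<open>'u\<close>. In the last clause a definition cannot quantify over
  all types; it ranges over all metric spaces whose points are real numbers (with an arbitrary
  metric, not the usual one). A separable metric space has at most continuum many points, so up
  to isometry these are all separable metric spaces: see \<open>urysohn_space_universal\<close> below.\<close>

definition urysohn_space_1 :: "'u::metric_space itself \<Rightarrow> bool" where
  "urysohn_space_1 (_ :: 'u itself) \<longleftrightarrow>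
     complete (UNIV :: 'u set) \<and>
     separable_space (euclidean :: 'u topology) \<and>
     metric_diameter (euclidean_metric :: 'u metric) = 1 \<and>
     (\<forall>(A :: 'u set) (B :: 'u set) f. finite A \<and> finite B \<and> f ` A = B \<and>
         (\<forall>x\<in>A. \<forall>y\<in>A. dist (f x) (f y) = dist x y) \<longrightarrow>
         (\<exists>g. surj g \<and> (\<forall>x y. dist (g x) (g y) = dist x y) \<and> (\<forall>x\<in>A. g x = f x))) \<and>
     (\<forall>m :: real metric. separable_space (mtopology_of m) \<and> metric_diameter m = 1 \<longrightarrow>
         (\<exists>h :: real \<Rightarrow> 'u. \<forall>x\<in>mspace m. \<forall>y\<in>mspace m. dist (h x) (h y) = mdist m x y))"

lemma separable_metric_lepoll_reals:
  fixes m :: "'a metric"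
  assumes "separable_space (mtopology_of m)"
  shows "mspace m \<lesssim> (UNIV :: real set)"
proof -
  interpret Metric_space "mspace m" "mdist m" by (rule Metric_space_mspace_mdist)
  obtain C where C: "countable C" "C \<subseteq> mspace m" "mtopology closure_of C = mspace m"
    using assms unfolding separable_space_def mtopology_of_def by auto
  define F where "F x = {to_nat (n, q) |n (q::rat). from_nat_into C n \<in> C \<and>
      mdist m (from_nat_into C n) x < of_rat q}" for x
  have "inj_on F (mspace m)"
  proof (rule inj_onI, rule ccontr)
    fix x y assume xy: "x \<in> mspace m" "y \<in> mspace m" "F x = F y" "x \<noteq> y"
    define r where "r = mdist m x y / 2"
    have r: "r > 0" using xy by (simp add: r_def)
    obtain c where c: "c \<in> C" "mdist m x c < r"
      using C(3) xy(1) r unfolding metric_closure_of by (auto simp: in_mball)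
    have cM: "c \<in> mspace m" using C c by auto
    obtain n where n: "from_nat_into C n = c"
      using from_nat_into_surj[OF C(1) c(1)] by auto
    obtain q where q: "mdist m x c < of_rat q" "of_rat q < r"
      using of_rat_dense[OF c(2)] by auto
    have "to_nat (n, q) \<in> F x" using q c n by (auto simp: F_def commute)
    then have "to_nat (n, q) \<in> F y" using xy by simp
    then have "mdist m c y < of_rat q" using n by (auto simp: F_def)
    moreover have "mdist m x y \<le> mdist m x c + mdist m c y" using triangle xy cM by auto
    ultimately show False using q by (simp add: r_def)
  qed
  then have "mspace m \<lesssim> (UNIV :: nat set set)" unfolding lepoll_def by blast
  then show ?thesis using nat_sets_eqpoll_reals lepoll_trans eqpoll_imp_lepoll by blast
qed

lemma urysohn_space_universal:
  fixes m :: "'a metric"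
  assumes "urysohn_space_1 TYPE('u::metric_space)"
    and sep: "separable_space (mtopology_of m)" and diam: "metric_diameter m = 1"
  shows "\<exists>h :: 'a \<Rightarrow> 'u. \<forall>x\<in>mspace m. \<forall>y\<in>mspace m. dist (h x) (h y) = mdist m x y"
proof -
  interpret Metric_space "mspace m" "mdist m" by (rule Metric_space_mspace_mdist)
  obtain e :: "'a \<Rightarrow> real" where e: "inj_on e (mspace m)"
    using separable_metric_lepoll_reals[OF sep] unfolding lepoll_def by auto
  define i where "i = inv_into (mspace m) e"
  define M where "M = e ` mspace m"
  have i: "i (e x) = x" if "x \<in> mspace m" for x using that e by (simp add: i_def)
  have iM: "i u \<in> mspace m" if "u \<in> M" for u using that i by (auto simp: M_def)
  have ms: "Metric_space M (\<lambda>u v. if u \<in> M \<and> v \<in> M then mdist m (i u) (i v) else 0)"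
    (is "Metric_space M ?d")
  proof
    fix x y z
    show "0 \<le> ?d x y" "?d x y = ?d y x" by (auto simp: commute)
    assume "x \<in> M" "y \<in> M"
    then show "?d x y = 0 \<longleftrightarrow> x = y"
      using i iM by (auto simp: M_def)
    assume "z \<in> M"
    then show "?d x z \<le> ?d x y + ?d y z"
      using \<open>x \<in> M\<close> \<open>y \<in> M\<close> iM triangle by auto
  qed
  define k where "k = metric (M, ?d)"
  have k: "mspace k = M" "mdist k = ?d"
    using ms by (simp_all add: k_def Metric_space.mspace_metric Metric_space.mdist_metric)
  have ke: "mdist k (e x) (e y) = mdist m x y" if "x \<in> mspace m" "y \<in> mspace m" for x y
    using that i by (simp add: k M_def)
  have "Lipschitz_continuous_map m k e"
    unfolding Lipschitz_continuous_map_def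
    using ke by (auto simp: k(1) M_def intro!: exI[of _ 1])
  then have "continuous_map (mtopology_of m) (mtopology_of k) e"
    by (rule Lipschitz_continuous_imp_continuous_map)
  moreover have "e ` topspace (mtopology_of m) = topspace (mtopology_of k)"
    by (simp add: k M_def)
  ultimately have "separable_space (mtopology_of k)"
    using separable_space_continuous_map_image[OF sep] by blast
  moreover have "metric_diameter k = metric_diameter m"
  proof -
    have "(\<lambda>(u, v). ereal (mdist k u v)) ` (mspace k \<times> mspace k) =
        (\<lambda>(x, y). ereal (mdist m x y)) ` (mspace m \<times> mspace m)"
      using ke by (force simp: k(1) M_def image_iff)
    then show ?thesis by (simp add: metric_diameter_def)
  qed
  ultimately obtain h :: "real \<Rightarrow> 'u"
    where h: "\<forall>u\<in>mspace k. \<forall>v\<in>mspace k. dist (h u) (h v) = mdist k u v"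
    using assms(1) diam unfolding urysohn_space_1_def by metis
  show ?thesis
    by (rule exI[of _ "h \<circ> e"]) (use h ke in \<open>auto simp: k(1) M_def\<close>)
qed

definition isom_group :: "('u::metric_space \<Rightarrow> 'u) monoid" where
  "isom_group =
     \<lparr>carrier = {g. surj g \<and> (\<forall>x y. dist (g x) (g y) = dist x y)}, mult = (\<circ>), one = id\<rparr>"

definition isom_topology :: "('u::metric_space \<Rightarrow> 'u) topology" where
  "isom_topology =
     subtopology (product_topology (\<lambda>_ :: 'u. euclidean) UNIV) (carrier isom_group)"

lift_definition bidual_embedding ::
  "'e::real_normed_vector \<Rightarrow> (('e \<Rightarrow>\<^sub>L real) \<Rightarrow>\<^sub>L real)" is "\<lambda>x \<phi>. blinfun_apply \<phi> x"
  by (rule blinfun.bounded_linear_left)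

definition reflexive_space :: "'e::real_normed_vector itself \<Rightarrow> bool" where
  "reflexive_space (_ :: 'e itself) \<longleftrightarrow>
     surj (bidual_embedding :: 'e \<Rightarrow> (('e \<Rightarrow>\<^sub>L real) \<Rightarrow>\<^sub>L real))"

definition linear_isom_group :: "('e::real_normed_vector \<Rightarrow>\<^sub>L 'e) monoid" where
  "linear_isom_group =
     \<lparr>carrier = {T. surj (blinfun_apply T) \<and> (\<forall>v. norm (blinfun_apply T v) = norm v)},
      mult = (o\<^sub>L), one = id_blinfun\<rparr>"

definition linear_isom_topology :: "('e::real_normed_vector \<Rightarrow>\<^sub>L 'e) topology" where
  "linear_isom_topology = subtopology strong_operator_topology (carrier linear_isom_group)"

lemma group_isom_group: "group (isom_group :: ('u::metric_space \<Rightarrow> 'u) monoid)"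
proof (rule groupI)
  fix g :: "'u \<Rightarrow> 'u" assume "g \<in> carrier isom_group"
  then have g: "surj g" "\<And>x y. dist (g x) (g y) = dist x y" by (auto simp: isom_group_def)
  have "inj g" by (rule injI) (metis g(2) dist_eq_0_iff)
  then have *: "inv_into UNIV g \<circ> g = id" by simp
  have "surj (inv_into UNIV g)" using \<open>inj g\<close> by (rule inj_imp_surj_inv)
  moreover have "dist (inv_into UNIV g x) (inv_into UNIV g y) = dist x y" for x y
    using g(2)[of "inv_into UNIV g x" "inv_into UNIV g y"] by (simp only: surj_f_inv_f[OF g(1)])
  ultimately show "\<exists>h\<in>carrier isom_group. h \<otimes>\<^bsub>isom_group\<^esub> g = \<one>\<^bsub>isom_group\<^esub>"
    using * by (intro bexI[of _ "inv_into UNIV g"]) (auto simp: isom_group_def)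
qed (use comp_surj in \<open>force simp: isom_group_def comp_assoc\<close>)+

lemma group_linear_isom_group:
  "group (linear_isom_group :: ('e::real_normed_vector \<Rightarrow>\<^sub>L 'e) monoid)"
proof (rule groupI)
  fix T :: "'e \<Rightarrow>\<^sub>L 'e" assume "T \<in> carrier linear_isom_group"
  then have T: "surj (blinfun_apply T)" "\<And>v. norm (T v) = norm v"
    by (auto simp: linear_isom_group_def)
  have inj: "inj (blinfun_apply T)"
  proof (rule injI)
    fix v w assume "T v = T w"
    then have "norm (T (v - w)) = 0" by (simp add: blinfun.diff_right)
    then show "v = w" by (simp add: T)
  qed
  define S where "S = inv_into UNIV (blinfun_apply T)"
  have S: "T (S v) = v" "S (T v) = v" for v
    unfolding S_def by (rule surj_f_inv_f[OF T(1)], rule inv_f_f[OF inj])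
  have bl: "bounded_linear S"
  proof (rule bounded_linear_intro[of _ 1])
    show "S (v + w) = S v + S w" for v w
      using S(2)[of "S v + S w"] by (simp only: blinfun.add_right S(1))
    show "S (r *\<^sub>R v) = r *\<^sub>R S v" for r v
      using S(2)[of "r *\<^sub>R S v"] by (simp only: blinfun.scaleR_right S(1))
    show "norm (S v) \<le> norm v * 1" for v
      using T(2)[of "S v"] by (simp only: S(1) mult_1_right order_refl)
  qed
  have "Blinfun S \<in> carrier linear_isom_group"
  proof -
    have "surj S" by (rule surjI) (rule S(2))
    moreover have "norm (S v) = norm v" for v using T(2)[of "S v"] by (simp only: S(1))
    ultimately show ?thesis
      by (simp add: linear_isom_group_def bounded_linear_Blinfun_apply[OF bl])
  qed
  moreover have "Blinfun S o\<^sub>L T = id_blinfun"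
    by (rule blinfun_eqI) (simp add: bounded_linear_Blinfun_apply[OF bl] S)
  ultimately show "\<exists>R\<in>carrier linear_isom_group.
      R \<otimes>\<^bsub>linear_isom_group\<^esub> T = \<one>\<^bsub>linear_isom_group\<^esub>"
    by (auto simp: linear_isom_group_def)
next
  fix S T :: "'e \<Rightarrow>\<^sub>L 'e"
  assume "S \<in> carrier linear_isom_group" "T \<in> carrier linear_isom_group"
  moreover from this have "surj (blinfun_apply S \<circ> blinfun_apply T)"
    by (intro comp_surj) (simp_all add: linear_isom_group_def)
  ultimately show "S \<otimes>\<^bsub>linear_isom_group\<^esub> T \<in> carrier linear_isom_group"
    by (simp add: linear_isom_group_def comp_def)
qed (auto simp: linear_isom_group_def surj_def intro!: blinfun_eqI)

end

theory Submission
  imports Defs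
begin

text \<open>Let \<open>v\<close> be a vector and \<open>\<epsilon> > 0\<close>. By continuity \<open>\<pi> g v\<close> is, up to a prescribed error,
  determined by the restriction of \<open>g\<close> to a finite set \<open>A\<close>, and it moves by less than \<open>\<epsilon>\<close> if the
  points of \<open>A\<close> are moved by at most some \<open>r > 0\<close>. A vector in the orbit of \<open>v\<close> is therefore nearly
  the same thing as an isometric copy of \<open>A\<close>. By homogeneity the norm of a linear combination of
  such vectors depends, up to a small error, only on the mutual distances of the copies
  (\<open>urysohn_transport_combination\<close>), and by universality these distances may be prescribed
  as \<open>min 1 (d(a,b) + w(i,j))\<close> for any metric \<open>w\<close> on a countable set of indices with two points
  at distance at least 1 (\<open>urysohn_copies\<close>).

  Reflexivity provides a weak cluster point of the orbit vectors of infinitely many copies with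
  \<open>w(i,j) = r\<close>. It lies in every closed tail hull, so that there are convex combinations
  \<open>u\<close>, \<open>u'\<close> of the orbit vectors over disjoint finite sets \<open>F\<close>, \<open>H\<close> of indices with \<open>u\<close> close to \<open>u'\<close>
  (\<open>reflexive_disjoint_convex_combinations\<close>). Closeness depends only on the pattern of distances,
  and in this pattern one may replace the copies over \<open>H\<close> while those over \<open>F\<close> stay, or conversely.
  Alternating the two, one walks from a combination of copies near \<open>A\<close> to the same combination
  of copies far away from \<open>A\<close>: the copies are indexed by pairs (level, index), copies on the same
  or on adjacent levels being \<open>r\<close> apart and the distance growing linearly with the difference of
  the levels. About \<open>1/r\<close> steps reach distance 1. Since \<open>r\<close> is chosen before the errors of a single
  step, the accumulated error is still small. On each level the combination is within \<open>\<epsilon>\<close> of each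
  of the vectors combined, so \<open>\<pi> k v\<close> is close to \<open>v\<close> whenever \<open>k\<close> moves \<open>A\<close> to a copy at distance
  1 from \<open>A\<close> (\<open>urysohn_far_moves_small\<close>).

  For arbitrary \<open>g\<close>, choose \<open>k\<close> that moves \<open>A\<close> to distance 1 from both \<open>A\<close> and \<open>g A\<close>. Then both \<open>k\<close>
  and \<open>g\<^sup>-\<^sup>1 k\<close> almost fix \<open>v\<close>, and so does \<open>g\<close>.\<close>

section \<open>Sublinear functionals and the Hahn--Banach theorem\<close>

definition sublinear :: "('a::real_vector \<Rightarrow> real) \<Rightarrow> bool" where
  "sublinear q \<longleftrightarrow>
     (\<forall>x y. q (x + y) \<le> q x + q y) \<and> (\<forall>t>0. \<forall>x. q (t *\<^sub>R x) = t * q x)"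

lemma sublinear_add: "sublinear q \<Longrightarrow> q (x + y) \<le> q x + q y"
  and sublinear_scale: "sublinear q \<Longrightarrow> 0 < t \<Longrightarrow> q (t *\<^sub>R x) = t * q x"
  by (auto simp: sublinear_def)

lemma sublinear_zero: "sublinear q \<Longrightarrow> q 0 = 0"
  using sublinear_scale[of q 2 0] by simp

lemma sublinear_ge_neg: "sublinear q \<Longrightarrow> - q (- x) \<le> q x"
  using sublinear_add[of q x "- x"] sublinear_zero[of q] by simp

lemma sublinearI:
  assumes add: "\<And>x y. q (x + y) \<le> q x + q y"
    and scale: "\<And>t x. 0 < t \<Longrightarrow> q (t *\<^sub>R x) \<le> t * q x"
  shows "sublinear q"
proof -
  have "q (t *\<^sub>R x) = t * q x" if "0 < t" for t x
    using scale[of t x] scale[of "1 / t" "t *\<^sub>R x"] that by (simp add: field_simps)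
  then show ?thesis using add by (simp add: sublinear_def)
qed

lemma cInf_le_add:
  fixes S A B :: "real set"
  assumes "A \<noteq> {}" "B \<noteq> {}" and le: "\<And>a b. a \<in> A \<Longrightarrow> b \<in> B \<Longrightarrow> Inf S \<le> a + b"
  shows "Inf S \<le> Inf A + Inf B"
proof -
  have "Inf S - Inf A \<le> b" if "b \<in> B" for b
  proof -
    have "Inf S - b \<le> Inf A"
      by (rule cInf_greatest) (use assms that in \<open>auto simp: algebra_simps\<close>)
    then show ?thesis by simp
  qed
  then have "Inf S - Inf A \<le> Inf B" using assms(2) by (intro cInf_greatest) auto
  then show ?thesis by simp
qed

text \<open>Take \<open>q z = inf {p (z + s k) - s d | s \<ge> 0, k \<in> K}\<close>: convexity of \<open>K\<close>
  makes it subadditive, and the bound \<open>d \<le> p\<close> on \<open>K\<close> keeps the infimum finite. With \<open>K\<close> a single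
  point it is the step that makes minimal sublinear functionals linear; with \<open>p\<close> the norm it
  separates \<open>K\<close> from the origin.\<close>

lemma sublinear_lower_on_convex:
  fixes p :: "'a::real_vector \<Rightarrow> real"
  assumes p: "sublinear p" and K: "convex K" "K \<noteq> {}" and d: "\<And>k. k \<in> K \<Longrightarrow> d \<le> p k"
  shows "\<exists>q. sublinear q \<and> q \<le> p \<and> (\<forall>k\<in>K. q (- k) \<le> - d)"
proof -
  define S where "S z = {p (z + s *\<^sub>R k) - s * d | s k. 0 \<le> s \<and> k \<in> K}" for z
  define q where "q z = Inf (S z)" for z
  have lower: "- p (- z) \<le> p (z + s *\<^sub>R k) - s * d" if "0 \<le> s" "k \<in> K" for z s k
  proof -
    have "s * d \<le> p (s *\<^sub>R k)"
      using that d sublinear_scale[OF p] sublinear_zero[OF p] by (cases "s = 0") auto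
    moreover have "p (s *\<^sub>R k) \<le> p (z + s *\<^sub>R k) + p (- z)"
      using sublinear_add[OF p, of "z + s *\<^sub>R k" "- z"] by simp
    ultimately show ?thesis by simp
  qed
  have bdd: "bdd_below (S z)" for z
    unfolding S_def using lower by (intro bdd_belowI[of _ "- p (- z)"]) auto
  have ne: "S z \<noteq> {}" for z using K by (auto simp: S_def)
  have q_le: "q z \<le> p (z + s *\<^sub>R k) - s * d" if "0 \<le> s" "k \<in> K" for z s k
    unfolding q_def by (rule cInf_lower[OF _ bdd]) (use that in \<open>auto simp: S_def\<close>)
  have "sublinear q"
  proof (rule sublinearI)
    fix x y
    show "q (x + y) \<le> q x + q y"
      unfolding q_def[of x] q_def[of y] q_def[of "x + y"]
    proof (rule cInf_le_add[OF ne ne])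
      fix a b assume "a \<in> S x" "b \<in> S y"
      then obtain s k t l where sk: "0 \<le> s" "k \<in> K" "a = p (x + s *\<^sub>R k) - s * d"
        and tl: "0 \<le> t" "l \<in> K" "b = p (y + t *\<^sub>R l) - t * d"
        by (auto simp: S_def)
      obtain j where j: "j \<in> K" "(s + t) *\<^sub>R j = s *\<^sub>R k + t *\<^sub>R l"
      proof (cases "s + t = 0")
        case True
        then have "s = 0" "t = 0" using sk(1) tl(1) by auto
        then show ?thesis using that[OF sk(2)] by simp
      next
        case False
        then have pos: "s + t > 0" using sk(1) tl(1) by simp
        have "(s / (s + t)) *\<^sub>R k + (t / (s + t)) *\<^sub>R l \<in> K"
          by (rule convexD[OF K(1) sk(2) tl(2)])
            (use pos sk(1) tl(1) in \<open>auto simp flip: add_divide_distrib\<close>)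
        then show ?thesis using False by (intro that) (auto simp: scaleR_add_right)
      qed
      have "q (x + y) \<le> p ((x + y) + (s + t) *\<^sub>R j) - (s + t) * d"
        using sk(1) tl(1) j(1) by (intro q_le) auto
      also have "(x + y) + (s + t) *\<^sub>R j = (x + s *\<^sub>R k) + (y + t *\<^sub>R l)"
        by (simp add: j(2))
      finally show "Inf (S (x + y)) \<le> a + b"
        using sublinear_add[OF p, of "x + s *\<^sub>R k" "y + t *\<^sub>R l"]
        by (simp add: sk(3) tl(3) q_def algebra_simps)
    qed
  next
    fix t :: real and x :: 'a assume t: "0 < t"
    have "q (t *\<^sub>R x) / t \<le> q x"
      unfolding q_def[of x]
    proof (rule cInf_greatest[OF ne])
      fix a assume "a \<in> S x"
      then obtain s k where sk: "0 \<le> s" "k \<in> K" "a = p (x + s *\<^sub>R k) - s * d"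
        by (auto simp: S_def)
      have "q (t *\<^sub>R x) \<le> p (t *\<^sub>R x + (t * s) *\<^sub>R k) - (t * s) * d"
        using sk t by (intro q_le) auto
      also have "t *\<^sub>R x + (t * s) *\<^sub>R k = t *\<^sub>R (x + s *\<^sub>R k)"
        by (simp add: scaleR_add_right)
      also have "p \<dots> = t * p (x + s *\<^sub>R k)" by (rule sublinear_scale[OF p t])
      finally show "q (t *\<^sub>R x) / t \<le> a"
        using t by (simp add: sk(3) field_simps)
    qed
    then show "q (t *\<^sub>R x) \<le> t * q x" using t by (simp add: field_simps)
  qed
  moreover have "q \<le> p"
  proof (rule le_funI)
    obtain k where "k \<in> K" using K by auto
    then show "q x \<le> p x" for x using q_le[of 0 k x] by simp
  qed
  moreover have "q (- k) \<le> - d" if "k \<in> K" for k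
    using q_le[of 1 k "- k"] that sublinear_zero[OF p] by simp
  ultimately show ?thesis by blast
qed

text \<open>By Zorn's lemma: the pointwise infimum of a chain is again sublinear, and it is finite
  because \<open>p x \<ge> - p (- x) \<ge> - q (- x)\<close> for every sublinear \<open>p \<le> q\<close>.\<close>

lemma minimal_sublinear_exists:
  fixes q :: "'a::real_vector \<Rightarrow> real"
  assumes q: "sublinear q"
  shows "\<exists>m. sublinear m \<and> m \<le> q \<and> (\<forall>p. sublinear p \<and> p \<le> m \<longrightarrow> p = m)"
proof -
  define A where "A = {p. sublinear p \<and> p \<le> q}"
  have "\<exists>m\<in>A. \<forall>p\<in>A. p \<le> m \<longrightarrow> p = m"
  proof (rule predicate_Zorn)
    show "partial_order_on A (relation_of (\<lambda>p r. r \<le> p) A)"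
      by (rule partial_order_on_relation_ofI) auto
  next
    fix C assume C: "C \<in> Chains (relation_of (\<lambda>p r. r \<le> p) A)"
    have CA: "sublinear p" "p \<le> q" if "p \<in> C" for p
      using Chains_relation_of[OF C] that by (auto simp: A_def)
    have total: "p \<le> r \<or> r \<le> p" if "p \<in> C" "r \<in> C" for p r
      using C that by (auto simp: Chains_def relation_of_def)
    show "\<exists>u\<in>A. \<forall>p\<in>C. u \<le> p"
    proof (cases "C = {}")
      case True
      then show ?thesis using q by (auto simp: A_def)
    next
      case False
      define u where "u x = Inf ((\<lambda>p. p x) ` C)" for x
      have bdd: "bdd_below ((\<lambda>p. p x) ` C)" for x
      proof (rule bdd_belowI2)
        fix p assume "p \<in> C"
        then show "- q (- x) \<le> p x"
          using sublinear_ge_neg[OF CA(1), of p x] le_funD[OF CA(2), of p "- x"] by simp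
      qed
      have u_le: "u x \<le> p x" if "p \<in> C" for p x
        unfolding u_def using that by (intro cInf_lower bdd) auto
      have "sublinear u"
      proof (rule sublinearI)
        fix x y
        show "u (x + y) \<le> u x + u y"
          unfolding u_def[of x] u_def[of y] u_def[of "x + y"]
        proof (rule cInf_le_add)
          fix a b assume "a \<in> (\<lambda>p. p x) ` C" "b \<in> (\<lambda>p. p y) ` C"
          then obtain p r where pr: "p \<in> C" "a = p x" "r \<in> C" "b = r y" by auto
          obtain m where m: "m \<in> C" "m \<le> p" "m \<le> r"
            using total[OF pr(1,3)] pr by blast
          have "u (x + y) \<le> m x + m y"
            using u_le[OF m(1), of "x + y"] sublinear_add[OF CA(1)[OF m(1)], of x y] by simp
          also have "\<dots> \<le> a + b"
            using le_funD[OF m(2), of x] le_funD[OF m(3), of y] by (simp add: pr)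
          finally show "Inf ((\<lambda>p. p (x + y)) ` C) \<le> a + b" by (simp add: u_def)
        qed (use False in auto)
      next
        fix t :: real and x :: 'a assume t: "0 < t"
        have "u (t *\<^sub>R x) / t \<le> u x"
          unfolding u_def[of x]
        proof (rule cInf_greatest)
          fix a assume "a \<in> (\<lambda>p. p x) ` C"
          then obtain p where p: "p \<in> C" "a = p x" by auto
          have "u (t *\<^sub>R x) \<le> t * p x"
            using u_le[OF p(1), of "t *\<^sub>R x"] sublinear_scale[OF CA(1)[OF p(1)] t] by simp
          then show "u (t *\<^sub>R x) / t \<le> a" using t p by (simp add: field_simps)
        qed (use False in auto)
        then show "u (t *\<^sub>R x) \<le> t * u x" using t by (simp add: field_simps)
      qed
      moreover have "u \<le> q"
      proof (rule le_funI)
        fix x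
        obtain p where "p \<in> C" using False by auto
        then show "u x \<le> q x" using u_le[of p x] le_funD[OF CA(2), of p x] by simp
      qed
      ultimately have "u \<in> A" by (simp add: A_def)
      then show ?thesis using u_le by (auto simp: le_fun_def intro!: bexI[of _ u])
    qed
  qed
  then show ?thesis unfolding A_def by (blast intro: order_trans)
qed

text \<open>A minimal sublinear functional \<open>m\<close> is linear: lowering it at the point \<open>x\<close> gives a sublinear
  functional below \<open>m\<close>, hence \<open>m\<close> itself, with value at most \<open>- m x\<close> at \<open>- x\<close>. So \<open>m\<close> is odd, and
  an odd sublinear functional is also superadditive.\<close>

theorem Hahn_Banach_sublinear:
  fixes q :: "'a::real_vector \<Rightarrow> real"
  assumes "sublinear q"
  shows "\<exists>f. linear f \<and> (\<forall>x. f x \<le> q x)"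
proof -
  obtain m where m: "sublinear m" "m \<le> q" and min: "\<And>p. sublinear p \<Longrightarrow> p \<le> m \<Longrightarrow> p = m"
    using minimal_sublinear_exists[OF assms] by blast
  have odd: "m (- x) = - m x" for x
  proof -
    obtain p where "sublinear p" "p \<le> m" "p (- x) \<le> - m x"
      using sublinear_lower_on_convex[OF m(1), of "{x}" "m x"] by auto
    then have "m (- x) \<le> - m x" using min by metis
    then show ?thesis using sublinear_ge_neg[OF m(1), of x] by simp
  qed
  have "linear m"
  proof (rule linearI)
    fix x y
    have "- m (x + y) \<le> - m x - m y"
      using sublinear_add[OF m(1), of "- x" "- y"] odd[of "x + y"] by (simp add: odd)
    then show "m (x + y) = m x + m y" using sublinear_add[OF m(1), of x y] by simp
  next
    fix r :: real and x
    have "m (r *\<^sub>R x) = r * m x" if "r < 0"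
      using odd[of "r *\<^sub>R x"] sublinear_scale[OF m(1), of "- r" x] that by simp
    then show "m (r *\<^sub>R x) = r *\<^sub>R m x"
      using sublinear_scale[OF m(1)] sublinear_zero[OF m(1)]
      by (cases r "0::real" rule: linorder_cases) auto
  qed
  then show ?thesis using m(2) by (auto simp: le_fun_def)
qed

lemma separate_convex_from_origin:
  fixes K :: "'a::real_normed_vector set"
  assumes "convex K" "\<And>k. k \<in> K \<Longrightarrow> d \<le> norm k"
  shows "\<exists>\<phi> :: 'a \<Rightarrow>\<^sub>L real. \<forall>k\<in>K. d \<le> \<phi> k"
proof (cases "K = {}")
  case False
  have "sublinear (norm :: 'a \<Rightarrow> real)"
    by (rule sublinearI) (auto simp: norm_triangle_ineq)
  from sublinear_lower_on_convex[OF this assms(1) False assms(2)]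
  obtain q :: "'a \<Rightarrow> real" where q: "sublinear q" "q \<le> norm" "\<forall>k\<in>K. q (- k) \<le> - d"
    by blast
  obtain f where f: "linear f" "\<And>x. f x \<le> q x" using Hahn_Banach_sublinear[OF q(1)] by blast
  have f_le: "f x \<le> norm x" for x using f(2)[of x] le_funD[OF q(2), of x] by simp
  have f_neg: "f (- x) = - f x" for x by (rule linear_neg[OF f(1)])
  have bl: "bounded_linear f"
  proof (rule bounded_linear.intro[OF f(1)], unfold_locales)
    have "norm (f x) \<le> norm x * 1" for x
      using f_le[of x] f_le[of "- x"] by (simp add: f_neg)
    then show "\<exists>K. \<forall>x. norm (f x) \<le> norm x * K" by blast
  qed
  have "d \<le> f k" if "k \<in> K" for k
    using f(2)[of "- k"] q(3) that by (fastforce simp: f_neg)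
  then show ?thesis
    by (intro exI[of _ "Blinfun f"]) (simp add: bounded_linear_Blinfun_apply[OF bl])
qed auto

section \<open>Convex combinations of a bounded sequence in a reflexive space\<close>

text \<open>The point \<open>z\<close> serves as a weak cluster point of the sequence: a linear functional on the
  dual that is dominated by the sublinear functional \<open>\<phi> \<mapsto> limsup \<phi> (x\<^sub>i)\<close> is bounded, so by
  reflexivity it is evaluation at a point.\<close>

lemma reflexive_limsup_point:
  fixes x :: "nat \<Rightarrow> 'e::real_normed_vector"
  assumes refl: "reflexive_space TYPE('e)" and bound: "\<And>i. norm (x i) \<le> M"
  shows "\<exists>z. \<forall>(\<phi> :: 'e \<Rightarrow>\<^sub>L real) c n. (\<forall>i\<ge>n. \<phi> (x i) \<le> c) \<longrightarrow> \<phi> z \<le> c"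
proof -
  \<comment> \<open>\<open>q \<phi>\<close> is the limes superior of \<open>\<phi> (x i)\<close>, written as the infimum of the eventual
    upper bounds.\<close>
  define S where "S \<phi> = {c. \<exists>n. \<forall>i\<ge>n. blinfun_apply \<phi> (x i) \<le> c}" for \<phi> :: "'e \<Rightarrow>\<^sub>L real"
  define q where "q \<phi> = Inf (S \<phi>)" for \<phi>
  have M: "0 \<le> M" using bound[of 0] norm_ge_zero order_trans by blast
  have val: "\<bar>blinfun_apply \<phi> (x i)\<bar> \<le> norm \<phi> * M" for \<phi> :: "'e \<Rightarrow>\<^sub>L real" and i
    using norm_blinfun[of \<phi> "x i"] mult_left_mono[OF bound[of i], of "norm \<phi>"] by simp
  have bdd: "bdd_below (S \<phi>)" for \<phi>
  proof (rule bdd_belowI)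
    fix c assume "c \<in> S \<phi>"
    then obtain n where "blinfun_apply \<phi> (x n) \<le> c" by (auto simp: S_def)
    then show "- (norm \<phi> * M) \<le> c" using val[of \<phi> n] by simp
  qed
  have S_norm: "norm \<phi> * M \<in> S \<phi>" for \<phi>
    using val[of \<phi>] by (auto simp: S_def abs_le_iff)
  then have ne: "S \<phi> \<noteq> {}" for \<phi> by blast
  have q_le: "q \<phi> \<le> c" if "c \<in> S \<phi>" for \<phi> c
    unfolding q_def using that bdd by (rule cInf_lower)
  have "sublinear q"
  proof (rule sublinearI)
    fix \<phi> \<psi>
    show "q (\<phi> + \<psi>) \<le> q \<phi> + q \<psi>"
      unfolding q_def[of \<phi>] q_def[of \<psi>] q_def[of "\<phi> + \<psi>"]
    proof (rule cInf_le_add[OF ne ne])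
      fix a b assume "a \<in> S \<phi>" "b \<in> S \<psi>"
      then obtain n k where nk: "\<And>i. i \<ge> n \<Longrightarrow> blinfun_apply \<phi> (x i) \<le> a"
          "\<And>i. i \<ge> k \<Longrightarrow> blinfun_apply \<psi> (x i) \<le> b" by (auto simp: S_def)
      have "a + b \<in> S (\<phi> + \<psi>)"
        unfolding S_def using nk
        by (auto simp: blinfun.add_left intro!: exI[of _ "max n k"] add_mono)
      then show "Inf (S (\<phi> + \<psi>)) \<le> a + b" using q_le by (simp add: q_def)
    qed
  next
    fix t :: real and \<phi> :: "'e \<Rightarrow>\<^sub>L real" assume t: "0 < t"
    have "q (t *\<^sub>R \<phi>) / t \<le> q \<phi>"
      unfolding q_def[of \<phi>]
    proof (rule cInf_greatest[OF ne])
      fix a assume "a \<in> S \<phi>"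
      then have "t * a \<in> S (t *\<^sub>R \<phi>)"
        using t by (auto simp: S_def blinfun.scaleR_left)
      then show "q (t *\<^sub>R \<phi>) / t \<le> a" using q_le t by (fastforce simp: field_simps)
    qed
    then show "q (t *\<^sub>R \<phi>) \<le> t * q \<phi>" using t by (simp add: field_simps)
  qed
  then obtain f where f: "linear f" "\<And>\<phi>. f \<phi> \<le> q \<phi>" using Hahn_Banach_sublinear by blast
  have f_le: "f \<phi> \<le> norm \<phi> * M" for \<phi> using f(2)[of \<phi>] q_le[OF S_norm, of \<phi>] by simp
  have bl: "bounded_linear f"
  proof (rule bounded_linear.intro[OF f(1)], unfold_locales)
    have "norm (f \<phi>) \<le> norm \<phi> * M" for \<phi>
      using f_le[of \<phi>] f_le[of "- \<phi>"] by (simp add: linear_neg[OF f(1)])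
    then show "\<exists>K. \<forall>x. norm (f x) \<le> norm x * K" by blast
  qed
  obtain z :: 'e where "bidual_embedding z = Blinfun f"
    using refl unfolding reflexive_space_def by (metis surjD)
  then have z: "blinfun_apply \<phi> z = f \<phi>" for \<phi>
    by (metis bidual_embedding.rep_eq bounded_linear_Blinfun_apply[OF bl])
  show ?thesis
  proof (intro exI[of _ z] allI impI)
    fix \<phi> :: "'e \<Rightarrow>\<^sub>L real" and c n assume "\<forall>i\<ge>n. blinfun_apply \<phi> (x i) \<le> c"
    then have "c \<in> S \<phi>" by (auto simp: S_def)
    then show "blinfun_apply \<phi> z \<le> c" using q_le f(2)[of \<phi>] by (fastforce simp: z)
  qed
qed

text \<open>A tail hull at positive distance from the cluster point \<open>z\<close> would be separated from it by
  a functional, which contradicts the choice of \<open>z\<close>.\<close>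

lemma reflexive_tail_hulls:
  fixes x :: "nat \<Rightarrow> 'e::real_normed_vector"
  assumes refl: "reflexive_space TYPE('e)" and bound: "\<And>i. norm (x i) \<le> M"
  shows "\<exists>z. \<forall>n. \<forall>d>0. \<exists>y\<in>convex hull (x ` {n..}). norm (y - z) < d"
proof -
  obtain z where z: "\<And>(\<phi> :: 'e \<Rightarrow>\<^sub>L real) c n. (\<And>i. i \<ge> n \<Longrightarrow> \<phi> (x i) \<le> c) \<Longrightarrow> \<phi> z \<le> c"
    using reflexive_limsup_point[of x, OF refl bound] by blast
  have "\<exists>y\<in>convex hull (x ` {n..}). norm (y - z) < d" if d: "0 < d" for n d
  proof (rule ccontr)
    assume "\<not> ?thesis"
    then have far: "d \<le> norm k" if "k \<in> (\<lambda>y. y - z) ` (convex hull (x ` {n..}))" for k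
      using that by fastforce
    have "convex ((\<lambda>y. y - z) ` (convex hull (x ` {n..})))"
      using convex_translation_subtract convex_convex_hull by blast
    from separate_convex_from_origin[OF this far]
    obtain \<phi> :: "'e \<Rightarrow>\<^sub>L real"
      where \<phi>: "\<And>y. y \<in> convex hull (x ` {n..}) \<Longrightarrow> d \<le> \<phi> (y - z)" by auto
    have "(- \<phi>) z \<le> - \<phi> z - d"
    proof (rule z[of n])
      fix i assume "n \<le> i"
      then show "(- \<phi>) (x i) \<le> - \<phi> z - d"
        using \<phi>[of "x i"] by (auto simp: blinfun.diff_right blinfun.minus_left hull_inc)
    qed
    then show False using d by (simp add: blinfun.minus_left)
  qed
  then show ?thesis by blast
qed

lemma convex_hull_image_sum:
  assumes "y \<in> convex hull (x ` J)"
  obtains F c where "finite F" "F \<subseteq> J" "\<And>i. i \<in> F \<Longrightarrow> 0 \<le> (c i :: real)" "sum c F = 1"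
    "y = (\<Sum>i\<in>F. c i *\<^sub>R x i)"
proof -
  obtain S u where S: "finite S" "S \<subseteq> x ` J" "\<forall>v\<in>S. 0 \<le> u v" "sum u S = 1"
      "(\<Sum>v\<in>S. u v *\<^sub>R v) = y"
    using assms unfolding convex_hull_explicit by blast
  obtain F where F: "F \<subseteq> J" "inj_on x F" "S = x ` F" using S(2) by (auto simp: subset_image_inj)
  show ?thesis
  proof
    show "finite F" using S(1) F by (simp add: finite_image_iff)
    show "sum (u \<circ> x) F = 1" using S(4) F by (simp add: sum.reindex)
    show "y = (\<Sum>i\<in>F. (u \<circ> x) i *\<^sub>R x i)" using S(5) F by (simp add: sum.reindex comp_def)
  qed (use S F in auto)
qed

text \<open>Approximate a point common to all closed tail hulls first by a combination over some finite
  \<open>F\<close>, and then by a combination over a tail that starts beyond \<open>F\<close>.\<close>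

proposition reflexive_disjoint_convex_combinations:
  fixes x :: "nat \<Rightarrow> 'e::real_normed_vector"
  assumes refl: "reflexive_space TYPE('e)" and bound: "\<And>i. norm (x i) \<le> M" and "0 < \<eta>"
  obtains F H :: "nat set" and a b :: "nat \<Rightarrow> real"
  where "finite F" "finite H" "F \<inter> H = {}"
    "\<And>i. i \<in> F \<Longrightarrow> 0 \<le> a i" "sum a F = 1" "\<And>i. i \<in> H \<Longrightarrow> 0 \<le> b i" "sum b H = 1"
    "norm ((\<Sum>i\<in>F. a i *\<^sub>R x i) - (\<Sum>i\<in>H. b i *\<^sub>R x i)) < \<eta>"
proof -
  obtain z where z: "\<And>n d. 0 < d \<Longrightarrow> \<exists>y\<in>convex hull (x ` {n..}). norm (y - z) < d"
    using reflexive_tail_hulls[of x, OF refl bound] by blast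
  obtain y where y: "y \<in> convex hull (x ` {0..})" "norm (y - z) < \<eta> / 2"
    using z[of "\<eta> / 2" 0] \<open>0 < \<eta>\<close> by auto
  obtain F a where F: "finite F" "\<And>i. i \<in> F \<Longrightarrow> 0 \<le> (a i :: real)" "sum a F = 1"
      "y = (\<Sum>i\<in>F. a i *\<^sub>R x i)"
    using convex_hull_image_sum[OF y(1)] by metis
  obtain n where n: "\<And>i. i \<in> F \<Longrightarrow> i < n"
    using F(1) by (metis finite_nat_set_iff_bounded)
  obtain w where w: "w \<in> convex hull (x ` {n..})" "norm (w - z) < \<eta> / 2"
    using z[of "\<eta> / 2" n] \<open>0 < \<eta>\<close> by auto
  obtain H b where H: "finite H" "H \<subseteq> {n..}" "\<And>i. i \<in> H \<Longrightarrow> 0 \<le> (b i :: real)" "sum b H = 1"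
      "w = (\<Sum>i\<in>H. b i *\<^sub>R x i)"
    using convex_hull_image_sum[OF w(1)] by metis
  have "norm (y - w) < \<eta>"
    using norm_triangle_ineq4[of "y - z" "w - z"] y(2) w(2) by simp
  then show ?thesis using F H n by (intro that[of F H a b]) force+
qed

section \<open>Isometries of the Urysohn space\<close>

lemma isom_group_carrier:
  "g \<in> carrier isom_group \<longleftrightarrow> surj g \<and> (\<forall>x y. dist (g x) (g y) = dist x y)"
  by (simp add: isom_group_def)

lemma isom_group_inverse:
  assumes "g \<in> carrier isom_group"
  obtains h where "h \<in> carrier isom_group" "h \<circ> g = id" "g \<circ> h = id"
proof -
  interpret group "isom_group :: ('a \<Rightarrow> 'a) monoid" by (rule group_isom_group)
  have "inv\<^bsub>isom_group\<^esub> g \<circ> g = id" "g \<circ> inv\<^bsub>isom_group\<^esub> g = id"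
    using l_inv[OF assms] r_inv[OF assms] by (simp_all add: isom_group_def)
  then show ?thesis using that inv_closed[OF assms] by blast
qed

lemma isom_group_comp:
  "g \<in> carrier isom_group \<Longrightarrow> h \<in> carrier isom_group \<Longrightarrow> g \<circ> h \<in> carrier isom_group"
  using monoid.m_closed[OF group.is_monoid[OF group_isom_group], of g h]
  by (simp add: isom_group_def)

lemma urysohn_dist_le_1:
  fixes x y :: "'u::metric_space"
  assumes "urysohn_space_1 TYPE('u)"
  shows "dist x y \<le> 1"
proof -
  have "ereal (dist x y) \<le> metric_diameter (euclidean_metric :: 'u metric)"
    unfolding metric_diameter_def by (rule SUP_upper2[of "(x, y)"]) auto
  then show ?thesis using assms by (simp add: urysohn_space_1_def)
qed

text \<open>Homogeneity for finite families of maps on \<open>A\<close>. The points \<open>g i a\<close> may coincide for different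
  \<open>(i, a)\<close>; equality of distances makes the points \<open>h i a\<close> coincide as well, so \<open>g i a \<mapsto> h i a\<close> is a
  well-defined isometry between finite sets.\<close>

lemma urysohn_move_family:
  fixes g h :: "'i \<Rightarrow> 'a \<Rightarrow> 'u::metric_space"
  assumes U: "urysohn_space_1 TYPE('u)" and fin: "finite I" "finite A"
    and eq: "\<And>i j a b. i \<in> I \<Longrightarrow> j \<in> I \<Longrightarrow> a \<in> A \<Longrightarrow> b \<in> A \<Longrightarrow>
      dist (h i a) (h j b) = dist (g i a) (g j b)"
  obtains s where "s \<in> carrier isom_group" "\<And>i a. i \<in> I \<Longrightarrow> a \<in> A \<Longrightarrow> s (g i a) = h i a"
proof -
  define P where "P = (\<lambda>(i, a). g i a) ` (I \<times> A)"
  have "\<exists>f. \<forall>i\<in>I. \<forall>a\<in>A. f (g i a) = h i a"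
  proof -
    define f where "f p = (let (i, a) = SOME (i, a). i \<in> I \<and> a \<in> A \<and> g i a = p in h i a)" for p
    have "f (g i a) = h i a" if ia: "i \<in> I" "a \<in> A" for i a
    proof -
      obtain j b where jb: "(SOME (j, b). j \<in> I \<and> b \<in> A \<and> g j b = g i a) = (j, b)"
        by fastforce
      have "case (j, b) of (j, b) \<Rightarrow> j \<in> I \<and> b \<in> A \<and> g j b = g i a"
        unfolding jb[symmetric] by (rule someI[of _ "(i, a)"]) (use ia in simp)
      then have "j \<in> I" "b \<in> A" "dist (h j b) (h i a) = 0"
        using eq[of j i b a] ia by auto
      then show ?thesis by (simp add: f_def jb)
    qed
    then show ?thesis by blast
  qed
  then obtain f where f: "\<And>i a. i \<in> I \<Longrightarrow> a \<in> A \<Longrightarrow> f (g i a) = h i a" by blast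
  have "finite P" unfolding P_def using fin by blast
  moreover have "\<forall>x\<in>P. \<forall>y\<in>P. dist (f x) (f y) = dist x y"
    by (auto simp: P_def f eq)
  ultimately have "\<exists>s. surj s \<and> (\<forall>x y. dist (s x) (s y) = dist x y) \<and> (\<forall>x\<in>P. s x = f x)"
    using U[unfolded urysohn_space_1_def, THEN conjunct2, THEN conjunct2, THEN conjunct2,
        THEN conjunct1, THEN spec[of _ P], THEN spec[of _ "f ` P"], THEN spec[of _ f]]
    by simp
  then obtain s where s: "surj s" "\<forall>x y. dist (s x) (s y) = dist x y" "\<forall>x\<in>P. s x = f x"
    by blast
  show ?thesis
  proof (rule that)
    show "s \<in> carrier isom_group" using s by (simp add: isom_group_carrier)
    show "s (g i a) = h i a" if "i \<in> I" "a \<in> A" for i a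
      using s(3) that by (auto simp: P_def f[symmetric])
  qed
qed

text \<open>Universality embeds the product of \<open>A\<close> with the index space, under the sum metric truncated
  at 1, and homogeneity extends each slice \<open>A \<times> {x}\<close> to an isometry of the whole space. The index
  points at distance at least 1 guarantee that the product has diameter 1.\<close>

proposition urysohn_copies:
  fixes w :: "'i::countable \<Rightarrow> 'i \<Rightarrow> real" and A :: "'u::metric_space set"
  assumes U: "urysohn_space_1 TYPE('u)" and A: "finite A" "A \<noteq> {}"
    and w: "Metric_space UNIV w" and far: "1 \<le> w x\<^sub>0 y\<^sub>0"
  obtains g :: "'i \<Rightarrow> 'u \<Rightarrow> 'u"
  where "\<And>x. g x \<in> carrier isom_group"
    "\<And>x y a b. a \<in> A \<Longrightarrow> b \<in> A \<Longrightarrow> dist (g x a) (g y b) = min 1 (dist a b + w x y)"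
proof -
  interpret W: Metric_space UNIV w by (rule w)
  define M where "M = A \<times> (UNIV :: 'i set)"
  define d :: "'u \<times> 'i \<Rightarrow> 'u \<times> 'i \<Rightarrow> real"
    where "d = (\<lambda>(a, x) (b, y). min 1 (dist a b + w x y))"
  have d: "d (a, x) (b, y) = min 1 (dist a b + w x y)" for a b x y by (simp add: d_def)
  have ms: "Metric_space M d"
  proof
    fix p q s :: "'u \<times> 'i"
    obtain a x b y c z where p: "p = (a, x)" "q = (b, y)" "s = (c, z)" by (cases p, cases q, cases s)
    show "0 \<le> d p q" by (simp add: p d)
    show "d p q = d q p" by (simp add: p d dist_commute W.commute)
    show "d p q = 0 \<longleftrightarrow> p = q"
      using W.nonneg[of x y] zero_le_dist[of a b]
      by (auto simp: p d min_def add_nonneg_eq_0_iff)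
    show "d p s \<le> d p q + d q s"
      using dist_triangle[of a c b] W.triangle[of x y z, OF UNIV_I UNIV_I UNIV_I] W.nonneg[of x y] W.nonneg[of y z]
        zero_le_dist[of a b] zero_le_dist[of b c]
      unfolding p d by linarith
  qed
  define m where "m = metric (M, d)"
  have m: "mspace m = M" "mdist m = d"
    using ms by (simp_all add: m_def Metric_space.mspace_metric Metric_space.mdist_metric)
  have "countable M" unfolding M_def using A(1) by (simp add: countable_finite)
  then have "separable_space (mtopology_of m)"
    unfolding separable_space_def by (intro exI[of _ M]) (use closure_of_topspace[of "mtopology_of m"] in \<open>simp add: m\<close>)
  moreover have "metric_diameter m = 1"
    unfolding metric_diameter_def
  proof (rule antisym)
    show "(SUP (p, q)\<in>mspace m \<times> mspace m. ereal (mdist m p q)) \<le> 1"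
      by (rule SUP_least) (auto simp: m d min_le_iff_disj one_ereal_def)
    obtain a where "a \<in> A" using A(2) by auto
    then show "1 \<le> (SUP (p, q)\<in>mspace m \<times> mspace m. ereal (mdist m p q))"
      using far by (intro SUP_upper2[of "((a, x\<^sub>0), (a, y\<^sub>0))"]) (auto simp: m M_def d)
  qed
  ultimately obtain h :: "'u \<times> 'i \<Rightarrow> 'u"
    where h: "\<forall>p\<in>M. \<forall>q\<in>M. dist (h p) (h q) = d p q"
    using urysohn_space_universal[OF U, of m] unfolding m by blast
  have "\<exists>s\<in>carrier isom_group. \<forall>a\<in>A. s a = h (a, x)" for x
  proof -
    have "dist (h (a, x)) (h (b, x)) = dist a b" if "a \<in> A" "b \<in> A" for a b
      using that h urysohn_dist_le_1[OF U, of a b] by (simp add: M_def d)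
    then obtain s where "s \<in> carrier isom_group" "\<And>a. a \<in> A \<Longrightarrow> s a = h (a, x)"
      using urysohn_move_family[OF U, of "{()}" A "\<lambda>_ a. h (a, x)" "\<lambda>_ a. a"] A(1) by auto
    then show ?thesis by blast
  qed
  then obtain g where g: "\<And>x. g x \<in> carrier isom_group" "\<And>x a. a \<in> A \<Longrightarrow> g x a = h (a, x)"
    by metis
  show ?thesis by (rule that[of g]) (use g h in \<open>auto simp: M_def d\<close>)
qed

text \<open>Points are pairs (level, index). This is \<open>r\<close> times the maximum of the discrete metric and the
  distance of the levels. Hence any choice of points with distinct indices on two adjacent levels
  is a discrete space with all distances \<open>r\<close>, like a single level.\<close>

definition level_dist :: "real \<Rightarrow> nat \<times> nat \<Rightarrow> nat \<times> nat \<Rightarrow> real" where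
  "level_dist r x y =
     (if x = y then 0 else r * max 1 \<bar>real (fst x) - real (fst y)\<bar>)"

lemma level_dist_metric:
  assumes "0 < r"
  shows "Metric_space UNIV (level_dist r)"
proof
  fix x y z :: "nat \<times> nat"
  show "0 \<le> level_dist r x y" "level_dist r x y = level_dist r y x"
    using assms by (auto simp: level_dist_def abs_minus_commute)
  show "level_dist r x y = 0 \<longleftrightarrow> x = y"
    using assms by (auto simp: level_dist_def max_def)
  have "r * max 1 \<bar>real (fst x) - real (fst z)\<bar>
      \<le> r * (max 1 \<bar>real (fst x) - real (fst y)\<bar> + max 1 \<bar>real (fst y) - real (fst z)\<bar>)"
    using assms by (intro mult_left_mono) auto
  then show "level_dist r x z \<le> level_dist r x y + level_dist r y z"
    using assms by (auto simp: level_dist_def distrib_left)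
qed

section \<open>Isometric representations\<close>

lemma representation_comp:
  assumes "\<pi> \<in> hom isom_group linear_isom_group"
    and "g \<in> carrier isom_group" "h \<in> carrier isom_group"
  shows "blinfun_apply (\<pi> (g \<circ> h)) v = \<pi> g (\<pi> h v)"
  using hom_mult[OF assms] by (simp add: isom_group_def linear_isom_group_def)

lemma representation_norm:
  assumes "\<pi> \<in> hom isom_group linear_isom_group" "g \<in> carrier isom_group"
  shows "norm (blinfun_apply (\<pi> g) v) = norm v"
  using hom_in_carrier[OF assms] by (simp add: linear_isom_group_def)

lemma representation_id:
  assumes "\<pi> \<in> hom isom_group linear_isom_group"
  shows "\<pi> id = id_blinfun"
  using hom_one[OF assms group_isom_group group_linear_isom_group]
  by (simp add: isom_group_def linear_isom_group_def)

text \<open>Continuity of the orbit map at the identity, in terms of a basic neighbourhood of the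
  topology of pointwise convergence.\<close>

lemma orbit_map_small_near_id:
  fixes \<pi> :: "('u::metric_space \<Rightarrow> 'u) \<Rightarrow> ('e::real_normed_vector \<Rightarrow>\<^sub>L 'e)"
  assumes hom: "\<pi> \<in> hom isom_group linear_isom_group"
    and cont: "continuous_map isom_topology linear_isom_topology \<pi>" and "0 < \<epsilon>"
  obtains A \<delta> where "finite A" "0 < \<delta>"
    "\<And>k. k \<in> carrier isom_group \<Longrightarrow> (\<And>a. a \<in> A \<Longrightarrow> dist (k a) a < \<delta>) \<Longrightarrow>
      norm (\<pi> k v - v) < \<epsilon>"
proof -
  have "continuous_map isom_topology euclidean (\<lambda>k. \<pi> k v)"
  proof -
    have "continuous_map linear_isom_topology euclidean (\<lambda>T. blinfun_apply T v)"
      unfolding linear_isom_topology_def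
      by (intro continuous_map_from_subtopology strong_operator_topology_continuous_evaluation)
    from continuous_map_compose[OF cont this] show ?thesis by (simp add: comp_def)
  qed
  then have "openin isom_topology {k \<in> topspace isom_topology. \<pi> k v \<in> ball v \<epsilon>}"
    by (rule openin_continuous_map_preimage) simp
  then obtain V where V: "openin (product_topology (\<lambda>_::'u. euclidean) UNIV) V"
      "{k \<in> topspace isom_topology. \<pi> k v \<in> ball v \<epsilon>} = V \<inter> carrier isom_group"
    unfolding isom_topology_def openin_subtopology by blast
  have top: "topspace isom_topology = (carrier isom_group :: ('u \<Rightarrow> 'u) set)"
    by (simp add: isom_topology_def)
  have "(id :: 'u \<Rightarrow> 'u) \<in> carrier isom_group" by (simp add: isom_group_carrier)
  then have "id \<in> {k \<in> topspace isom_topology. \<pi> k v \<in> ball v \<epsilon>}"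
    using \<open>0 < \<epsilon>\<close> by (simp add: top representation_id[OF hom])
  then have "id \<in> V" unfolding V(2) by blast
  from product_topology_open_contains_basis[OF V(1) this]
  obtain X where X: "id \<in> (\<Pi>\<^sub>E i\<in>UNIV. X i)" "\<And>i. open (X i)" "finite {i. X i \<noteq> UNIV}"
      "(\<Pi>\<^sub>E i\<in>UNIV. X i) \<subseteq> V" by auto
  define A where "A = {i. X i \<noteq> UNIV}"
  have "\<exists>e>0. \<forall>y. dist y a < e \<longrightarrow> y \<in> X a" for a
    using X(1) X(2)[of a] by (auto simp: open_dist PiE_iff)
  then obtain e where e: "\<And>a. 0 < e a" "\<And>a y. dist y a < e a \<Longrightarrow> y \<in> X a" by metis
  define \<delta> where "\<delta> = Min (insert 1 (e ` A))"
  have fin: "finite A" using X(3) by (simp add: A_def)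
  show ?thesis
  proof (rule that[of A \<delta>])
    show "finite A" by (rule fin)
    show "0 < \<delta>" unfolding \<delta>_def using fin e(1) by (subst Min_gr_iff) auto
    fix k :: "'u \<Rightarrow> 'u" assume k: "k \<in> carrier isom_group" "\<And>a. a \<in> A \<Longrightarrow> dist (k a) a < \<delta>"
    have "k a \<in> X a" for a
    proof (cases "a \<in> A")
      case True
      then have "\<delta> \<le> e a" unfolding \<delta>_def using fin by (intro Min_le) auto
      then show ?thesis using k(2)[OF True] e(2) by auto
    qed (simp add: A_def)
    then have "k \<in> V" using X(4) by auto
    then have "\<pi> k v \<in> ball v \<epsilon>" using V(2) k(1) by blast
    then show "norm (\<pi> k v - v) < \<epsilon>" by (simp add: dist_norm norm_minus_commute)
  qed
qed

text \<open>The metric and the norm are both invariant under the group, so an estimate near the identity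
  holds for any two elements that are close to each other on \<open>A\<close>.\<close>

lemma representation_dist_le:
  assumes hom: "\<pi> \<in> hom isom_group linear_isom_group"
    and g: "g \<in> carrier isom_group" and h: "h \<in> carrier isom_group"
    and small: "\<And>k. k \<in> carrier isom_group \<Longrightarrow> (\<And>a. a \<in> A \<Longrightarrow> dist (k a) a \<le> \<delta>) \<Longrightarrow>
      norm (blinfun_apply (\<pi> k) v - v) \<le> \<epsilon>"
    and close: "\<And>a. a \<in> A \<Longrightarrow> dist (g a) (h a) \<le> \<delta>"
  shows "norm (\<pi> g v - \<pi> h v) \<le> \<epsilon>"
proof -
  obtain h' where h': "h' \<in> carrier isom_group" "h' \<circ> h = id" "h \<circ> h' = id"
    using isom_group_inverse[OF h] by metis
  have k: "h' \<circ> g \<in> carrier isom_group" by (rule isom_group_comp[OF h'(1) g])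
  have "dist ((h' \<circ> g) a) a \<le> \<delta>" if "a \<in> A" for a
  proof -
    have "dist ((h' \<circ> g) a) ((h' \<circ> h) a) = dist (g a) (h a)"
      using h'(1) by (simp add: isom_group_carrier)
    then show ?thesis using close[OF that] h'(2) by simp
  qed
  then have "norm (\<pi> (h' \<circ> g) v - v) \<le> \<epsilon>" using small[OF k] by blast
  moreover have "\<pi> h (\<pi> (h' \<circ> g) v) = \<pi> g v"
    using representation_comp[OF hom h k, of v] h'(3) by (simp flip: comp_assoc)
  then have "\<pi> g v - \<pi> h v = \<pi> h (\<pi> (h' \<circ> g) v - v)" by (simp add: blinfun.diff_right)
  ultimately show ?thesis by (simp add: representation_norm[OF hom h])
qed

text \<open>Some isometry \<open>s\<close> carries the copies \<open>g i\<close> of \<open>A\<close> to the copies \<open>h i\<close>. Then \<open>h i\<close> and \<open>s \<circ> g i\<close>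
  agree on \<open>A\<close>, so \<open>\<pi> (h i) v\<close> is within \<open>\<epsilon>\<close> of \<open>\<pi> s (\<pi> (g i) v)\<close>, and \<open>\<pi> s\<close> preserves the norm
  of the combination.\<close>

lemma urysohn_transport_combination:
  fixes \<pi> :: "('u::metric_space \<Rightarrow> 'u) \<Rightarrow> ('e::real_normed_vector \<Rightarrow>\<^sub>L 'e)"
  assumes U: "urysohn_space_1 TYPE('u)" and hom: "\<pi> \<in> hom isom_group linear_isom_group"
    and fin: "finite I" "finite A"
    and fix_A: "\<And>k. k \<in> carrier isom_group \<Longrightarrow> (\<And>a. a \<in> A \<Longrightarrow> k a = a) \<Longrightarrow>
      norm (\<pi> k v - v) \<le> \<epsilon>"
    and g: "\<And>i. i \<in> I \<Longrightarrow> g i \<in> carrier isom_group"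
    and h: "\<And>i. i \<in> I \<Longrightarrow> h i \<in> carrier isom_group"
    and eq: "\<And>i j a b. i \<in> I \<Longrightarrow> j \<in> I \<Longrightarrow> a \<in> A \<Longrightarrow> b \<in> A \<Longrightarrow>
      dist (h i a) (h j b) = dist (g i a) (g j b)"
  shows "norm (\<Sum>i\<in>I. c i *\<^sub>R \<pi> (h i) v) \<le> norm (\<Sum>i\<in>I. c i *\<^sub>R \<pi> (g i) v) + (\<Sum>i\<in>I. \<bar>c i\<bar>) * \<epsilon>"
proof -
  obtain s where s: "s \<in> carrier isom_group" "\<And>i a. i \<in> I \<Longrightarrow> a \<in> A \<Longrightarrow> s (g i a) = h i a"
    by (rule urysohn_move_family[OF U fin, where g = g and h = h]) (use eq in blast)+
  have step: "norm (\<pi> (h i) v - \<pi> s (\<pi> (g i) v)) \<le> \<epsilon>" if i: "i \<in> I" for i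
  proof -
    have "norm (\<pi> (h i) v - \<pi> (s \<circ> g i) v) \<le> \<epsilon>"
    proof (rule representation_dist_le[where A = A and \<delta> = 0,
          OF hom h[OF i] isom_group_comp[OF s(1) g[OF i]]])
      show "norm (\<pi> k v - v) \<le> \<epsilon>"
        if "k \<in> carrier isom_group" "\<And>a. a \<in> A \<Longrightarrow> dist (k a) a \<le> 0" for k
        using fix_A[OF that(1)] that(2) by simp
      show "dist (h i a) ((s \<circ> g i) a) \<le> 0" if "a \<in> A" for a
        using s(2)[OF i that] by simp
    qed
    then show ?thesis by (simp add: representation_comp[OF hom s(1) g[OF i]])
  qed
  have "(\<Sum>i\<in>I. c i *\<^sub>R \<pi> (h i) v) =
      \<pi> s (\<Sum>i\<in>I. c i *\<^sub>R \<pi> (g i) v) + (\<Sum>i\<in>I. c i *\<^sub>R (\<pi> (h i) v - \<pi> s (\<pi> (g i) v)))"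
    by (simp add: blinfun.sum_right blinfun.scaleR_right scaleR_diff_right flip: sum.distrib)
  moreover have "norm (\<Sum>i\<in>I. c i *\<^sub>R (\<pi> (h i) v - \<pi> s (\<pi> (g i) v))) \<le> (\<Sum>i\<in>I. \<bar>c i\<bar> * \<epsilon>)"
    by (rule sum_norm_le) (auto intro!: mult_left_mono step)
  ultimately show ?thesis
    using norm_triangle_ineq[of "\<pi> s (\<Sum>i\<in>I. c i *\<^sub>R \<pi> (g i) v)"
        "\<Sum>i\<in>I. c i *\<^sub>R (\<pi> (h i) v - \<pi> s (\<pi> (g i) v))"]
    by (simp add: representation_norm[OF hom s(1)] sum_distrib_right)
qed

text \<open>The walk through the levels. With \<open>u l\<close> the combination over \<open>F\<close> on level \<open>l\<close> and \<open>w l\<close> the one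
  over \<open>H\<close>, the vectors \<open>u l\<close> and \<open>w (l + 1)\<close> are as close as \<open>u 0\<close> and \<open>w 0\<close> up to the transport error, and
  so are \<open>w (l + 1)\<close> and \<open>u (l + 2)\<close>: the sets \<open>F\<close> and \<open>H\<close> being disjoint, the pairs (level, index)
  involved always form a discrete space with all distances \<open>r\<close>.\<close>

proposition urysohn_far_moves_small:
  fixes \<pi> :: "('u::metric_space \<Rightarrow> 'u) \<Rightarrow> ('e::real_normed_vector \<Rightarrow>\<^sub>L 'e)"
  assumes U: "urysohn_space_1 TYPE('u)" and refl: "reflexive_space TYPE('e)"
    and hom: "\<pi> \<in> hom isom_group linear_isom_group"
    and cont: "continuous_map isom_topology linear_isom_topology \<pi>" and "0 < \<epsilon>"
  obtains A where "finite A" "A \<noteq> {}"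
    "\<And>k. k \<in> carrier isom_group \<Longrightarrow> (\<And>a b. a \<in> A \<Longrightarrow> b \<in> A \<Longrightarrow> dist a (k b) = 1) \<Longrightarrow>
      norm (\<pi> k v - v) \<le> 5 * \<epsilon>"
proof -
  obtain A\<^sub>0 \<delta> where A\<^sub>0: "finite A\<^sub>0" "0 < \<delta>"
      "\<And>k. k \<in> carrier isom_group \<Longrightarrow> (\<And>a. a \<in> A\<^sub>0 \<Longrightarrow> dist (k a) a < \<delta>) \<Longrightarrow>
        norm (\<pi> k v - v) < \<epsilon>"
    using orbit_map_small_near_id[OF hom cont \<open>0 < \<epsilon>\<close>] by blast
  define r where "r = \<delta> / 2"
  have r: "0 < r" "r < \<delta>" using A\<^sub>0(2) by (auto simp: r_def)
  obtain L :: nat where L: "1 < L * r" using ex_less_of_nat_mult[OF r(1)] by auto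
  have L0: "0 < L" using L by (cases L) auto
  \<comment> \<open>The walk takes \<open>L\<close> double steps of error \<open>6 * \<eta>\<close> each. The number \<open>L\<close> depends only on the
    modulus of continuity \<open>\<delta>\<close> for \<open>\<epsilon>\<close>, so \<open>\<eta>\<close> can be adapted to it.\<close>
  define \<eta> where "\<eta> = \<epsilon> / (6 * real L)"
  have \<eta>: "0 < \<eta>" "\<eta> \<le> \<epsilon>" "L * (6 * \<eta>) = \<epsilon>"
    using \<open>0 < \<epsilon>\<close> L0 by (auto simp: \<eta>_def field_simps)
  obtain A\<^sub>1 \<delta>\<^sub>1 where A\<^sub>1: "finite A\<^sub>1" "0 < \<delta>\<^sub>1"
      "\<And>k. k \<in> carrier isom_group \<Longrightarrow> (\<And>a. a \<in> A\<^sub>1 \<Longrightarrow> dist (k a) a < \<delta>\<^sub>1) \<Longrightarrow>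
        norm (\<pi> k v - v) < \<eta>"
    using orbit_map_small_near_id[OF hom cont \<eta>(1)] by blast
  \<comment> \<open>The arbitrary extra point makes \<open>A\<close> nonempty.\<close>
  define A where "A = insert undefined (A\<^sub>0 \<union> A\<^sub>1)"
  have A: "finite A" "A \<noteq> {}" using A\<^sub>0 A\<^sub>1 by (auto simp: A_def)
  have near: "norm (\<pi> k v - v) \<le> \<epsilon>"
    if "k \<in> carrier isom_group" "\<And>a. a \<in> A \<Longrightarrow> dist (k a) a \<le> r" for k
    using A\<^sub>0(3)[OF that(1)] that(2) r(2) by (force simp: A_def)
  have fix_A: "norm (\<pi> k v - v) \<le> \<eta>"
    if "k \<in> carrier isom_group" "\<And>a. a \<in> A \<Longrightarrow> k a = a" for k
    using A\<^sub>1(3)[OF that(1)] that(2) A\<^sub>1(2) by (force simp: A_def)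
  have "1 \<le> level_dist r (0, 0) (L, 0)"
    using L r L0 by (auto simp: level_dist_def mult.commute)
  then obtain g where g: "\<And>x. g x \<in> carrier isom_group"
      "\<And>x y a b. a \<in> A \<Longrightarrow> b \<in> A \<Longrightarrow>
        dist (g x a) (g y b) = min 1 (dist a b + level_dist r x y)"
    using urysohn_copies[OF U A level_dist_metric[OF r(1)]] by blast
  define V where "V x = \<pi> (g x) v" for x
  have V_bound: "norm (V x) \<le> norm v" for x
    by (simp add: V_def representation_norm[OF hom g(1)])
  obtain F H and c d :: "nat \<Rightarrow> real" where FH: "finite F" "finite H" "F \<inter> H = {}"
      "\<And>i. i \<in> F \<Longrightarrow> 0 \<le> c i" "sum c F = 1" "\<And>i. i \<in> H \<Longrightarrow> 0 \<le> d i" "sum d H = 1"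
      "norm ((\<Sum>i\<in>F. c i *\<^sub>R V (0, i)) - (\<Sum>i\<in>H. d i *\<^sub>R V (0, i))) < \<eta>"
    by (rule reflexive_disjoint_convex_combinations[of "\<lambda>i. V (0, i)" "norm v" \<eta>,
          OF refl V_bound \<eta>(1)]) blast
  define u where "u l = (\<Sum>i\<in>F. c i *\<^sub>R V (l, i))" for l
  define w where "w l = (\<Sum>i\<in>H. d i *\<^sub>R V (l, i))" for l
  \<comment> \<open>With these coefficients a difference of combinations over \<open>F\<close> and \<open>H\<close> is one
    combination over \<open>F \<union> H\<close>.\<close>
  define e where "e i = (if i \<in> F then c i else - d i)" for i
  have split: "(\<Sum>i\<in>F \<union> H. e i *\<^sub>R f i) = (\<Sum>i\<in>F. c i *\<^sub>R f i) - (\<Sum>i\<in>H. d i *\<^sub>R f i)"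
    for f :: "nat \<Rightarrow> 'e"
  proof -
    have "(\<Sum>i\<in>F. e i *\<^sub>R f i) = (\<Sum>i\<in>F. c i *\<^sub>R f i)" by (simp add: e_def)
    moreover have "(\<Sum>i\<in>H. e i *\<^sub>R f i) = (\<Sum>i\<in>H. - (d i *\<^sub>R f i))"
      using FH(3) by (intro sum.cong) (auto simp: e_def)
    ultimately show ?thesis using FH(1-3) by (simp add: sum.union_disjoint sum_negf)
  qed
  have abs_e: "(\<Sum>i\<in>F \<union> H. \<bar>e i\<bar>) = 2"
  proof -
    have "(\<Sum>i\<in>F. \<bar>e i\<bar>) = 1" using FH(4,5) by (simp add: e_def)
    moreover have "(\<Sum>i\<in>H. \<bar>e i\<bar>) = sum d H"
      using FH(3,6) by (intro sum.cong) (auto simp: e_def)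
    ultimately show ?thesis using FH(1-3,7) by (simp add: sum.union_disjoint)
  qed
  have adjacent: "norm (u l - w l') \<le> 3 * \<eta>" if ll: "l' = Suc l \<or> l = Suc l'" for l l'
  proof -
    define \<sigma> where "\<sigma> i = (if i \<in> F then l else l', i)" for i
    have dist_\<sigma>: "level_dist r (\<sigma> i) (\<sigma> j) = level_dist r (0, i) (0, j)" for i j
      using ll by (auto simp: \<sigma>_def level_dist_def)
    have "norm (\<Sum>i\<in>F \<union> H. e i *\<^sub>R \<pi> (g (\<sigma> i)) v) \<le>
        norm (\<Sum>i\<in>F \<union> H. e i *\<^sub>R \<pi> (g (0, i)) v) + (\<Sum>i\<in>F \<union> H. \<bar>e i\<bar>) * \<eta>"
      by (rule urysohn_transport_combination[OF U hom _ A(1) fix_A])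
        (use FH(1,2) g dist_\<sigma> in auto)
    moreover have "(\<Sum>i\<in>F \<union> H. e i *\<^sub>R \<pi> (g (\<sigma> i)) v) = u l - w l'"
    proof -
      have "(\<Sum>i\<in>F. c i *\<^sub>R V (\<sigma> i)) = u l" by (simp add: u_def \<sigma>_def)
      moreover have "(\<Sum>i\<in>H. d i *\<^sub>R V (\<sigma> i)) = w l'"
        unfolding w_def using FH(3) by (intro sum.cong) (auto simp: \<sigma>_def)
      ultimately show ?thesis by (simp add: split flip: V_def)
    qed
    ultimately show ?thesis using FH(8) by (simp add: split abs_e flip: V_def)
  qed
  have chain: "norm (u (2 * n) - u 0) \<le> n * (6 * \<eta>)" for n
  proof (induction n)
    case (Suc n)
    have "u (2 * Suc n) - u 0 =
        (u (2 * Suc n) - w (Suc (2 * n))) - (u (2 * n) - w (Suc (2 * n))) + (u (2 * n) - u 0)"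
      by simp
    moreover have "norm \<dots> \<le> 3 * \<eta> + 3 * \<eta> + n * (6 * \<eta>)"
      by (intro norm_triangle_mono norm_triangle_le_diff add_mono adjacent Suc.IH
          order_trans[OF norm_triangle_ineq4]) auto
    ultimately show ?case by (simp add: algebra_simps)
  qed simp
  have u_near: "norm (u l - V (l, 0)) \<le> \<epsilon>" for l
  proof -
    have "u l - V (l, 0) = (\<Sum>i\<in>F. c i *\<^sub>R (V (l, i) - V (l, 0)))"
      using FH(5) by (simp add: u_def scaleR_diff_right sum_subtractf flip: scaleR_left.sum)
    also have "norm \<dots> \<le> (\<Sum>i\<in>F. c i * \<epsilon>)"
    proof (rule sum_norm_le)
      fix i assume i: "i \<in> F"
      have "norm (V (l, i) - V (l, 0)) \<le> \<epsilon>"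
        unfolding V_def
        by (rule representation_dist_le[OF hom g(1) g(1) near])
          (use r(1) in \<open>auto simp: g(2) level_dist_def\<close>)
      then show "norm (c i *\<^sub>R (V (l, i) - V (l, 0))) \<le> c i * \<epsilon>"
        using FH(4)[OF i] by (simp add: mult_left_mono)
    qed
    also have "\<dots> = \<epsilon>" using FH(5) by (simp flip: sum_distrib_right)
    finally show ?thesis .
  qed
  have ends: "norm (V (2 * L, 0) - V (0, 0)) \<le> 3 * \<epsilon>"
  proof -
    have eq: "V (2 * L, 0) - V (0, 0) =
        (u (2 * L) - u 0) - (u (2 * L) - V (2 * L, 0)) + (u 0 - V (0, 0))" by simp
    show ?thesis
      unfolding eq
      using norm_triangle_ineq[of "(u (2 * L) - u 0) - (u (2 * L) - V (2 * L, 0))" "u 0 - V (0, 0)"]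
        norm_triangle_ineq4[of "u (2 * L) - u 0" "u (2 * L) - V (2 * L, 0)"]
        chain[of L] \<eta>(3) u_near[of "2 * L"] u_near[of 0]
      by linarith
  qed
  show ?thesis
  proof (rule that[OF A])
    fix k :: "'u \<Rightarrow> 'u"
    assume k: "k \<in> carrier isom_group" "\<And>a b. a \<in> A \<Longrightarrow> b \<in> A \<Longrightarrow> dist a (k b) = 1"
    \<comment> \<open>The pair of copies \<open>A\<close>, \<open>k A\<close> has the same distances as the pair of copies with index 0
      on the levels \<open>0\<close> and \<open>2 * L\<close>, so the estimate \<open>ends\<close> carries over.\<close>
    define h where "h b = (if b then k else id)" for b
    define f where "f b = (if b then g (2 * L, 0) else g (0, 0))" for b
    define s where "s b = (if b then 1 else - 1 :: real)" for b
    have far: "1 \<le> level_dist r (2 * L, 0) (0, 0)" "1 \<le> level_dist r (0, 0) (2 * L, 0)"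
      using L r(1) L0 by (auto simp: level_dist_def algebra_simps)
    have k': "dist (k a) b = 1" if "a \<in> A" "b \<in> A" for a b
      using k(2)[OF that(2,1)] by (simp add: dist_commute)
    have k'': "dist (k a) (k b) = dist a b" for a b using k(1) by (simp add: isom_group_carrier)
    have same: "dist (g x a) (g x b) = dist a b" for x a b
      using g(1)[of x] by (simp add: isom_group_carrier)
    have dist_eq: "dist (h x a) (h y b) = dist (f x a) (f y b)" if "a \<in> A" "b \<in> A" for x y a b
      using that far k(2) k' k'' same
      by (cases x; cases y) (auto simp: h_def f_def g(2) add_increasing)
    have "norm (\<Sum>b\<in>UNIV. s b *\<^sub>R \<pi> (h b) v) \<le>
        norm (\<Sum>b\<in>UNIV. s b *\<^sub>R \<pi> (f b) v) + (\<Sum>b\<in>UNIV. \<bar>s b\<bar>) * \<eta>"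
      by (rule urysohn_transport_combination[OF U hom _ A(1) fix_A])
        (use g(1) k(1) dist_eq in \<open>auto simp: h_def f_def isom_group_carrier\<close>)
    then have "norm (\<pi> k v - v) \<le> norm (V (2 * L, 0) - V (0, 0)) + 2 * \<eta>"
      by (simp add: UNIV_bool s_def h_def f_def V_def representation_id[OF hom] algebra_simps)
    then show "norm (\<pi> k v - v) \<le> 5 * \<epsilon>" using ends \<eta>(2) by simp
  qed
qed

theorem corollary1p4:
  fixes \<pi> :: "('u::metric_space \<Rightarrow> 'u) \<Rightarrow> ('e::banach \<Rightarrow>\<^sub>L 'e)"
  assumes "urysohn_space_1 TYPE('u)"
    and "reflexive_space TYPE('e)"
    and "\<pi> \<in> hom isom_group linear_isom_group"
    and "continuous_map isom_topology linear_isom_topology \<pi>"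
  shows "\<forall>g \<in> carrier isom_group. \<pi> g = id_blinfun"
proof (intro ballI blinfun_eqI)
  fix g :: "'u \<Rightarrow> 'u" and v :: 'e
  assume g: "g \<in> carrier isom_group"
  obtain g' where g': "g' \<in> carrier isom_group" "g' \<circ> g = id" "g \<circ> g' = id"
    using isom_group_inverse[OF g] by metis
  have "norm (\<pi> g v - v) \<le> 0 + \<epsilon>" if "0 < \<epsilon>" for \<epsilon>
  proof -
    have \<epsilon>10: "0 < \<epsilon> / 10" using that by simp
    obtain A where A: "finite A" "A \<noteq> {}"
        "\<And>k. k \<in> carrier isom_group \<Longrightarrow> (\<And>a b. a \<in> A \<Longrightarrow> b \<in> A \<Longrightarrow> dist a (k b) = 1) \<Longrightarrow>
          norm (\<pi> k v - v) \<le> 5 * (\<epsilon> / 10)"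
      using urysohn_far_moves_small[OF assms \<epsilon>10] by blast
    \<comment> \<open>An isometry \<open>k\<close> taking \<open>B\<close> to distance 1 from \<open>B\<close> comes from two copies of \<open>B\<close> on adjacent
      levels, for \<open>r = 1\<close>.\<close>
    define B where "B = A \<union> g ` A"
    have B: "finite B" "B \<noteq> {}" using A by (auto simp: B_def)
    obtain f where f: "\<And>x. f x \<in> carrier isom_group"
        "\<And>x y a b. a \<in> B \<Longrightarrow> b \<in> B \<Longrightarrow>
          dist (f x a) (f y b) = min 1 (dist a b + level_dist 1 x y)"
      using urysohn_copies[OF assms(1) B level_dist_metric[of 1], of "(0, 0)" "(1, 0)"]
      by (auto simp: level_dist_def)
    obtain f' where f': "f' \<in> carrier isom_group" "f' \<circ> f (0, 0) = id"
      using isom_group_inverse[OF f(1)[of "(0, 0)"]] by metis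
    define k where "k = f' \<circ> f (1, 0)"
    have k: "k \<in> carrier isom_group" unfolding k_def by (rule isom_group_comp[OF f'(1) f(1)])
    have far: "dist a (k b) = 1" if "a \<in> B" "b \<in> B" for a b
    proof -
      have "dist a (k b) = dist (f' (f (0, 0) a)) (f' (f (1, 0) b))"
        using fun_cong[OF f'(2), of a] by (simp add: k_def)
      also have "\<dots> = dist (f (0, 0) a) (f (1, 0) b)" using f'(1) by (simp add: isom_group_carrier)
      also have "\<dots> = 1" by (simp add: f(2)[OF that] level_dist_def)
      finally show ?thesis .
    qed
    have g'k: "g' \<circ> k \<in> carrier isom_group" by (rule isom_group_comp[OF g'(1) k])
    have "dist a ((g' \<circ> k) b) = 1" if "a \<in> A" "b \<in> A" for a b
    proof -
      have "dist a ((g' \<circ> k) b) = dist (g' (g a)) (g' (k b))"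
        using fun_cong[OF g'(2), of a] by simp
      also have "\<dots> = dist (g a) (k b)" using g'(1) by (simp add: isom_group_carrier)
      also have "\<dots> = 1" using that by (intro far) (auto simp: B_def)
      finally show ?thesis .
    qed
    then have "norm (\<pi> (g' \<circ> k) v - v) \<le> \<epsilon> / 2" using A(3)[OF g'k] by simp
    moreover have "norm (\<pi> k v - v) \<le> \<epsilon> / 2" using A(3)[OF k] far by (simp add: B_def)
    moreover have "norm (\<pi> k v - \<pi> g v) = norm (\<pi> (g' \<circ> k) v - v)"
    proof -
      have "\<pi> g (\<pi> (g' \<circ> k) v) = \<pi> k v"
        using representation_comp[OF assms(3) g g'k, of v] g'(3) by (simp flip: comp_assoc)
      then have "\<pi> k v - \<pi> g v = \<pi> g (\<pi> (g' \<circ> k) v - v)" by (simp add: blinfun.diff_right)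
      then show ?thesis by (simp add: representation_norm[OF assms(3) g])
    qed
    ultimately show ?thesis
      using norm_triangle_ineq4[of "\<pi> k v - v" "\<pi> k v - \<pi> g v"] by simp
  qed
  then have "norm (\<pi> g v - v) \<le> 0" by (rule field_le_epsilon)
  then show "\<pi> g v = id_blinfun v" by simp
qed

end
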